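(* Let $n\ge 1$ and let $G$ be a weighted graph on the vertex set $\{1,\dotsc,n\}$ with non-negative edge weights $a_{i,j}$ ($1\le i<j\le n$). Let $0=\lambda_0\le\lambda_1\le\dotsb\le\lambda_{n-1}$ be the eigenvalues of the continuous-time Laplacian of the random walk on $G$, and for $t\ge 0$ let $s_n(t)$ be the number of cycles of length $n$ in the interchange process on $G$ at time $t$. Then for every $t\ge 0$, $$\mathbb{P}(s_n(t)=1)=\frac1n\prod_{i=1}^{n-1}\left(1-e^{-\lambda_i t}\right).$$
   Context: Weighted graph: a collection of non-negative numbers $a_{i,j}$, $1\le i<j\le n$ (with $a_{i,j}=0$ meaning there is no edge $\{i,j\}$); put $a_{j,i}=a_{i,j}$. Interchange process on $G$: the continuous-time Markov chain on the symmetric group $S_n$ that starts at the identity permutation at time $0$ and, for each $i<j$, jumps from $g$ to $(ij)g$ with rate $a_{i,j}$. Equivalently, its distribution at time $t$ is the element $e^{-t\Delta}=\sum_{k\ge0}(-t\Delta)^k/k!$ of the group ring $\mathbb{R}[S_n]$ (viewed as a function on $S_n$), where $\Delta=\sum_{i<j}a_{i,j}(\mathbf 1-(ij))$. $s_k(t)$ is the number of cycles of length $k$ (with fixed points counted as cycles of length 1) of the permutation given by the process at time $t$. Continuous-time Laplacian of the random walk on $G$: the $n\times n$ symmetric matrix $L$ with $L_{ij}=-a_{i,j}$ for $i\neq j$ and $L_{ii}=\sum_{j\ne i}a_{i,j}$. Eigenvalues are listed with multiplicity. *)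

theory Defs
  imports
    "HOL-Probability.Probability_Measure"
    "HOL-Combinatorics.Permutations"
    "HOL-Combinatorics.Orbits"
    "Jordan_Normal_Form.Char_Poly"
begin

definition weighted_graph :: "nat \<Rightarrow> (nat \<Rightarrow> nat \<Rightarrow> real) \<Rightarrow> bool" where
  "weighted_graph n a \<longleftrightarrow>
     (\<forall>i\<in>{1..n}. \<forall>j\<in>{1..n}. i \<noteq> j \<longrightarrow> 0 \<le> a i j \<and> a j i = a i j)"

text \<open>Vertices are numbered from 1, matrix indices from 0: the vertex \<open>Suc r\<close> has row \<open>r\<close>.\<close>

definition graph_laplacian :: "nat \<Rightarrow> (nat \<Rightarrow> nat \<Rightarrow> real) \<Rightarrow> real mat" where
  "graph_laplacian n a = mat n n (\<lambda>(r, s).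
     if r = s then (\<Sum>j\<in>{1..n} - {Suc r}. a (Suc r) j) else - a (Suc r) (Suc s))"

definition Sym :: "nat \<Rightarrow> (nat \<Rightarrow> nat) set" where
  "Sym n = {p. p permutes {1..n}}"

text \<open>Elements of the group ring of the symmetric group are represented by their coefficient
  functions; only the values on \<open>Sym n\<close> are meaningful. The inverse permutation is written \<open>inv_into UNIV\<close>
  because HOL-Algebra claims the notation \<open>inv\<close>.\<close>

type_synonym group_ring = "(nat \<Rightarrow> nat) \<Rightarrow> real"

definition gr_of :: "(nat \<Rightarrow> nat) \<Rightarrow> group_ring" where
  "gr_of p = (\<lambda>g. if g = p then 1 else 0)"

definition gr_mult :: "nat \<Rightarrow> group_ring \<Rightarrow> group_ring \<Rightarrow> group_ring" where
  "gr_mult n u v = (\<lambda>g. \<Sum>x\<in>Sym n. u x * v (inv_into UNIV x \<circ> g))"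

definition gr_power :: "nat \<Rightarrow> group_ring \<Rightarrow> nat \<Rightarrow> group_ring" where
  "gr_power n u k = (gr_mult n u ^^ k) (gr_of id)"

text \<open>The series converges absolutely at every permutation; see \<open>summable_gr_exp\<close> below.\<close>

definition gr_exp :: "nat \<Rightarrow> group_ring \<Rightarrow> group_ring" where
  "gr_exp n u = (\<lambda>g. \<Sum>k. gr_power n u k g / fact k)"

definition gr_laplacian :: "nat \<Rightarrow> (nat \<Rightarrow> nat \<Rightarrow> real) \<Rightarrow> group_ring" where
  "gr_laplacian n a = (\<lambda>g. \<Sum>j\<in>{1..n}. \<Sum>i\<in>{1..<j}.
     a i j * (gr_of id g - gr_of (Transposition.transpose i j) g))"

definition heat_kernel :: "nat \<Rightarrow> (nat \<Rightarrow> nat \<Rightarrow> real) \<Rightarrow> real \<Rightarrow> group_ring" where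
  "heat_kernel n a t = gr_exp n (\<lambda>g. - t * gr_laplacian n a g)"

text \<open>The continuous-time Markov chain with state space \<open>Sym n\<close>, started at the identity, whose
  rate of jumping from \<open>g\<close> to \<open>transpose i j \<circ> g\<close> is \<open>a i j\<close>, described by its finite-dimensional
  distributions. Since the jumps multiply on the left, the transition probability from \<open>g\<close> to \<open>h\<close>
  in time \<open>t\<close> is the coefficient of \<open>h \<circ> inv_into UNIV g\<close> in \<open>heat_kernel n a t\<close>.
  No regularity of the sample paths is required.\<close>

definition interchange_process ::
  "nat \<Rightarrow> (nat \<Rightarrow> nat \<Rightarrow> real) \<Rightarrow> 'w measure \<Rightarrow> (real \<Rightarrow> 'w \<Rightarrow> nat \<Rightarrow> nat) \<Rightarrow> bool" where
  "interchange_process n a M X \<longleftrightarrow>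
     prob_space M \<and>
     (\<forall>t\<ge>0. X t \<in> measurable M (count_space (Sym n))) \<and>
     (\<forall>m (t :: nat \<Rightarrow> real) (g :: nat \<Rightarrow> nat \<Rightarrow> nat).
        t 0 = 0 \<and> (\<forall>k<m. t k \<le> t (Suc k)) \<and> g 0 = id \<and> (\<forall>k\<le>m. g k \<in> Sym n) \<longrightarrow>
        measure M {w \<in> space M. \<forall>k\<le>m. X (t k) w = g k} =
          (\<Prod>k<m. heat_kernel n a (t (Suc k) - t k) (g (Suc k) \<circ> inv_into UNIV (g k))))"

text \<open>The cycles of a permutation, fixed points included, are its orbits.\<close>

definition cycle_count :: "nat \<Rightarrow> nat \<Rightarrow> (nat \<Rightarrow> nat) \<Rightarrow> nat" where
  "cycle_count n k p = card {C \<in> orbit p ` {1..n}. card C = k}"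

lemma finite_Sym: "finite (Sym n)"
  unfolding Sym_def by (rule finite_permutations) simp

lemma abs_gr_power_le: "\<bar>gr_power n u k g\<bar> \<le> (\<Sum>x\<in>Sym n. \<bar>u x\<bar>) ^ k"
proof (induction k arbitrary: g)
  case 0
  show ?case by (simp add: gr_power_def gr_of_def)
next
  case (Suc k)
  have "\<bar>gr_power n u (Suc k) g\<bar> = \<bar>\<Sum>x\<in>Sym n. u x * gr_power n u k (inv_into UNIV x \<circ> g)\<bar>"
    by (simp add: gr_power_def gr_mult_def)
  also have "\<dots> \<le> (\<Sum>x\<in>Sym n. \<bar>u x\<bar> * \<bar>gr_power n u k (inv_into UNIV x \<circ> g)\<bar>)"
    by (rule order_trans[OF sum_abs]) (simp add: abs_mult)
  also have "\<dots> \<le> (\<Sum>x\<in>Sym n. \<bar>u x\<bar> * (\<Sum>x\<in>Sym n. \<bar>u x\<bar>) ^ k)"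
    by (intro sum_mono mult_left_mono Suc.IH) simp
  also have "\<dots> = (\<Sum>x\<in>Sym n. \<bar>u x\<bar>) ^ Suc k"
    by (simp add: sum_distrib_right)
  finally show ?case .
qed

lemma summable_gr_exp: "summable (\<lambda>k. \<bar>gr_power n u k g / fact k\<bar>)"
proof (rule summable_comparison_test'[where N = 0])
  show "summable (\<lambda>k. (\<Sum>x\<in>Sym n. \<bar>u x\<bar>) ^ k / fact k)"
    using summable_exp[of "\<Sum>x\<in>Sym n. \<bar>u x\<bar>"] by (simp add: field_simps)
  show "norm \<bar>gr_power n u k g / fact k\<bar> \<le> (\<Sum>x\<in>Sym n. \<bar>u x\<bar>) ^ k / fact k" for k
    using abs_gr_power_le[of n u k g] by (simp add: divide_right_mono)
qed

end

theory Submission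
  imports Defs "Jordan_Normal_Form.Schur_Decomposition"
begin

text \<open>Write \<open>P g\<close> for the permutation matrix of \<open>g\<close> and \<open>L\<close> for the Laplacian. Passing from \<open>g\<close> to
  \<open>transpose i j \<circ> g\<close> changes the matrix \<open>1 - x * P g * exp (- t * L)\<close> by a matrix of rank one, along
  which the determinant is affine; as \<open>L\<close> is the weighted sum of the matrices \<open>1 - P (transpose i j)\<close>,
  the determinant solves the backward equation of the interchange process. Hence the expectation of
  \<open>det (1 - x * P g)\<close> at time \<open>t\<close> is \<open>det (1 - x * exp (- t * L))\<close>, the product of all
  \<open>1 - x * exp (- \<lambda> * t)\<close>. Since \<open>det (1 - x * P g)\<close> is \<open>1 - x ^ n\<close> for a cycle of length \<open>n\<close> and is
  divisible by \<open>(1 - x)\<^sup>2\<close> otherwise, dividing by \<open>1 - x\<close> and letting \<open>x\<close> tend to 1 gives the claim.\<close>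

subsection \<open>Determinants along rank one perturbations\<close>

text \<open>Entry functions are curried so that \<open>f k\<close> is row \<open>k\<close> and
  replacing a row is the function update \<open>f(k := r)\<close>.\<close>

definition rdet :: "nat \<Rightarrow> (nat \<Rightarrow> nat \<Rightarrow> real) \<Rightarrow> real" where
  "rdet n f = det (mat n n (\<lambda>(i, j). f i j))"

lemma rdet_leibniz:
  "rdet n f = (\<Sum>q | q permutes {0..<n}. of_int (sign q) * (\<Prod>i = 0..<n. f i (q i)))"
  unfolding rdet_def
  by (subst det_def'[where n = n]) (auto intro!: sum.cong prod.cong simp: permutes_in_image dest: permutes_in_image)

lemma rdet_cong:
  assumes "\<And>i j. i < n \<Longrightarrow> j < n \<Longrightarrow> f i j = g i j"
  shows "rdet n f = rdet n g"
  unfolding rdet_def by (rule arg_cong[where f = det]) (auto intro!: eq_matI simp: assms)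

text \<open>Each Leibniz term contains exactly one factor from row \<open>k\<close>. Isolating it
  exposes the linearity in that row, on which the row rules and the derivative formula rest.\<close>

lemma rdet_expand_row:
  assumes "k < n"
  shows "rdet n (f(k := r)) =
    (\<Sum>q | q permutes {0..<n}. of_int (sign q) * (r (q k) * (\<Prod>i\<in>{0..<n} - {k}. f i (q i))))"
  unfolding rdet_leibniz using assms
  by (intro sum.cong refl arg_cong2[where f = "(*)"], subst prod.remove[of _ k])
     (auto intro!: prod.cong)

lemma rdet_row_sum:
  assumes "k < n"
  shows "rdet n (f(k := (\<lambda>j. \<Sum>e\<in>S. c e * r e j))) = (\<Sum>e\<in>S. c e * rdet n (f(k := r e)))"
  unfolding rdet_expand_row[OF assms]
  by (simp add: sum_distrib_left sum_distrib_right sum.swap[of _ _ S] mult_ac)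

lemma rdet_row_add:
  assumes "k < n"
  shows "rdet n (f(k := (\<lambda>j. r j + c * r' j))) = rdet n (f(k := r)) + c * rdet n (f(k := r'))"
  unfolding rdet_expand_row[OF assms] sum_distrib_left sum.distrib[symmetric]
  by (rule sum.cong) (simp_all add: distrib_left distrib_right mult_ac)

lemma rdet_row_scale:
  assumes "k < n"
  shows "rdet n (f(k := (\<lambda>j. c * r j))) = c * rdet n (f(k := r))"
  unfolding rdet_expand_row[OF assms] by (simp add: sum_distrib_left mult_ac)

lemma rdet_identical_rows:
  assumes "i \<noteq> j" "i < n" "j < n" "\<And>k. k < n \<Longrightarrow> f i k = f j k"
  shows "rdet n f = 0"
  unfolding rdet_def
  by (rule det_identical_rows[OF _ assms(1-3)]) (use assms in \<open>auto intro!: eq_vecI\<close>)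

text \<open>The product rule in each Leibniz term, regrouped by the row that is
  differentiated.\<close>

lemma has_derivative_rdet:
  assumes "\<And>i j. i < n \<Longrightarrow> j < n \<Longrightarrow> ((\<lambda>t. f t i j) has_field_derivative h i j) (at t)"
  shows "((\<lambda>t. rdet n (f t)) has_field_derivative (\<Sum>k<n. rdet n ((f t)(k := h k)))) (at t)"
proof -
  have *: "(\<Sum>k<n. rdet n ((f t)(k := h k))) =
    (\<Sum>q | q permutes {0..<n}. of_int (sign q) *
       (\<Sum>k\<in>{0..<n}. h k (q k) * (\<Prod>i\<in>{0..<n} - {k}. f t i (q i))))"
    by (simp add: rdet_expand_row sum_distrib_left sum.swap[of _ "{..<n}"] atLeast0LessThan)
  show ?thesis
    unfolding * unfolding rdet_leibniz
    by (intro DERIV_sum DERIV_cmult has_field_derivative_prod assms)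
       (auto dest: permutes_in_image)
qed

text \<open>Along a rank one perturbation the determinant is affine, so its increment is its
  derivative.\<close>

lemma rdet_rank_one_increment:
  fixes r :: "nat \<Rightarrow> real"
  assumes "p \<noteq> q" "p < n" "q < n"
  defines "h \<equiv> (\<lambda>i j. if i = p then r j else if i = q then - r j else (0::real))"
  shows "rdet n (\<lambda>i j. f i j + h i j) = rdet n f + (\<Sum>k<n. rdet n (f(k := h k)))"
proof -
  \<comment> \<open>Only the rows \<open>p\<close> and \<open>q\<close> of \<open>h\<close> can be
    nonzero, so the sum over \<open>k\<close> reduces to two terms.\<close>
  have z: "rdet n (f(k := (\<lambda>j. 0))) = 0" if "k < n" for k
    using that by (simp add: rdet_expand_row)
  have "(\<Sum>k<n. rdet n (f(k := h k))) = (\<Sum>k\<in>{p, q}. rdet n (f(k := h k)))"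
    by (rule sum.mono_neutral_right) (use assms z in \<open>auto simp: h_def\<close>)
  also have "\<dots> = rdet n (f(p := r)) + rdet n (f(q := (\<lambda>j. - r j)))"
    using assms by (simp add: h_def)
  also have "\<dots> = rdet n (f(p := r)) - rdet n (f(q := r))"
    using rdet_row_scale[OF assms(3), of f "-1" r] by simp
  finally have D: "(\<Sum>k<n. rdet n (f(k := h k))) = rdet n (f(p := r)) - rdet n (f(q := r))" .
  \<comment> \<open>Expanding in row \<open>q\<close> and then in row \<open>p\<close> leaves,
    besides the linear terms, one quadratic term; it has \<open>r\<close> in both rows and
    vanishes.\<close>
  have "rdet n (\<lambda>i j. f i j + h i j) =
      rdet n ((f(p := (\<lambda>j. f p j + 1 * r j)))(q := (\<lambda>j. f q j + (-1) * r j)))"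
    by (rule rdet_cong) (use assms in \<open>auto simp: h_def\<close>)
  also have "\<dots> = rdet n (f(p := (\<lambda>j. f p j + 1 * r j))) -
      rdet n ((f(q := r))(p := (\<lambda>j. f p j + 1 * r j)))"
    unfolding rdet_row_add[OF assms(3)] using assms(1) by (simp add: fun_upd_twist)
  also have "\<dots> = rdet n f + rdet n (f(p := r)) - (rdet n (f(q := r)) + rdet n (f(q := r, p := r)))"
    unfolding rdet_row_add[OF assms(2)] using assms(1) by (simp add: fun_upd_idem)
  also have "rdet n (f(q := r, p := r)) = 0"
    by (rule rdet_identical_rows[OF assms(1-3)]) (use assms in auto)
  finally show ?thesis unfolding D by (simp add: fun_upd_def)
qed

subsection \<open>Characteristic determinants of permutations\<close>

text \<open>Replacing row \<open>i0\<close> by the sum of the rows in \<open>S\<close> keeps the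
  determinant, and as \<open>p\<close> permutes \<open>S\<close>, that sum is \<open>1 - x\<close>
  times the indicator of \<open>S\<close>. Rows outside \<open>S\<close> are arbitrary, so the
  argument can be repeated on a disjoint set once row \<open>i0\<close> has changed.\<close>

lemma rdet_invariant_rows:
  assumes S: "S \<subseteq> {..<n}" "i0 \<in> S" and p: "bij_betw p S S"
    and f: "\<And>i j. i \<in> S \<Longrightarrow> j < n \<Longrightarrow> f i j = of_bool (i = j) - x * of_bool (p i = j)"
  shows "rdet n f = (1 - x) * rdet n (f(i0 := (\<lambda>j. of_bool (j \<in> S))))"
proof -
  have fin: "finite S" using S(1) finite_subset by blast
  have i0: "i0 < n" using S by auto
  have col: "(\<Sum>i\<in>S. f i j) = (1 - x) * of_bool (j \<in> S)" if j: "j < n" for j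
  proof -
    have "(\<Sum>i\<in>S. f i j) = (\<Sum>i\<in>S. of_bool (i = j)) - x * (\<Sum>i\<in>S. of_bool (p i = j))"
      by (simp add: f j sum_subtractf sum_distrib_left)
    also have "(\<Sum>i\<in>S. of_bool (p i = j)) = (\<Sum>i\<in>S. of_bool (i = j) :: real)"
      using sum.reindex_bij_betw[OF p, of "\<lambda>i. of_bool (i = j)"] by simp
    also have "(\<Sum>i\<in>S. of_bool (i = j) :: real) = of_bool (j \<in> S)"
      using fin by (simp add: of_bool_def)
    finally show ?thesis by (simp add: algebra_simps)
  qed
  have "rdet n (f(i0 := (\<lambda>j. \<Sum>i\<in>S. 1 * f i j))) = (\<Sum>i\<in>S. 1 * rdet n (f(i0 := f i)))"
    by (rule rdet_row_sum[OF i0])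
  \<comment> \<open>For \<open>i\<close> in \<open>S\<close> other than \<open>i0\<close>, the row
    \<open>f i\<close> occurs twice.\<close>
  also have "\<dots> = (\<Sum>i\<in>{i0}. rdet n (f(i0 := f i)))"
  proof (simp only: mult_1, rule sum.mono_neutral_right)
    show "\<forall>i\<in>S - {i0}. rdet n (f(i0 := f i)) = 0"
    proof
      fix i assume "i \<in> S - {i0}"
      then show "rdet n (f(i0 := f i)) = 0"
        using S i0 by (intro rdet_identical_rows[of i0 i]) auto
    qed
  qed (use fin S in auto)
  finally have "rdet n f = rdet n (f(i0 := (\<lambda>j. \<Sum>i\<in>S. f i j)))" by simp
  also have "\<dots> = rdet n (f(i0 := (\<lambda>j. (1 - x) * of_bool (j \<in> S))))"
    by (rule rdet_cong) (simp add: col)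
  finally show ?thesis by (simp add: rdet_row_scale[OF i0])
qed

text \<open>This is \<open>det (1 - x * P)\<close> for the permutation matrix \<open>P\<close> with
  entry 1 at \<open>(i, p i)\<close>, the reversed characteristic polynomial.\<close>

definition perm_det :: "nat \<Rightarrow> (nat \<Rightarrow> nat) \<Rightarrow> real \<Rightarrow> real" where
  "perm_det n p x = rdet n (\<lambda>i j. of_bool (i = j) - x * of_bool (p i = j))"

text \<open>An invariant set and its complement each contribute a factor \<open>1 - x\<close>; the
  remaining determinant \<open>K\<close> is polynomial in \<open>x\<close>.\<close>

lemma perm_det_intransitive:
  assumes p: "p permutes {..<n}" and S: "S \<subset> {..<n}" "S \<noteq> {}" "p ` S \<subseteq> S"
  shows "\<exists>K. isCont K 1 \<and> (\<forall>x. perm_det n p x = (1 - x) * ((1 - x) * K x))"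
proof -
  define T where "T = {..<n} - S"
  have fin: "finite S" using S(1) finite_subset by blast
  have inj: "inj_on p A" for A using permutes_inj[OF p] inj_on_subset by blast
  \<comment> \<open>Finiteness and injectivity turn inclusion into equality, so the complement
    \<open>T\<close> is invariant as well.\<close>
  have imS: "p ` S = S" using endo_inj_surj[OF fin S(3) inj] .
  have "p ` T = T"
    unfolding T_def using image_set_diff[OF permutes_inj[OF p]] permutes_image[OF p] imS by metis
  then have bij: "bij_betw p S S" "bij_betw p T T"
    using imS inj by (auto simp: bij_betw_def)
  obtain i0 i1 where i: "i0 \<in> S" "i1 \<in> T" using S T_def by blast
  define g where "g x = (\<lambda>i j. of_bool (i = j) - x * of_bool (p i = j) :: real)" for x
  define g0 where "g0 x = (g x)(i0 := (\<lambda>j. of_bool (j \<in> S)))" for x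
  define K where "K x = rdet n ((g0 x)(i1 := (\<lambda>j. of_bool (j \<in> T))))" for x
  have "perm_det n p x = (1 - x) * rdet n (g0 x)" for x
    unfolding g0_def perm_det_def using S
    by (subst rdet_invariant_rows[OF _ i(1) bij(1)]) (auto simp: g_def)
  \<comment> \<open>The row changed in \<open>g0\<close> lies in \<open>S\<close>, so the rows in
    \<open>T\<close> still have their original form.\<close>
  moreover have "rdet n (g0 x) = (1 - x) * K x" for x
    unfolding K_def using i
    by (intro rdet_invariant_rows[OF _ i(2) bij(2)]) (auto simp: g0_def g_def T_def)
  moreover have "isCont K 1"
    unfolding K_def rdet_leibniz g0_def g_def fun_upd_def
  proof (intro continuous_intros)
    fix q i
    show "isCont (\<lambda>x. (if i = i1 then \<lambda>j. of_bool (j \<in> T)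
      else if i = i0 then \<lambda>j. of_bool (j \<in> S)
      else (\<lambda>j. of_bool (i = j) - x * of_bool (p i = j))) (q i) :: real) 1"
      by (cases "i = i1"; cases "i = i0") (auto intro!: continuous_intros)
  qed
  ultimately show ?thesis by metis
qed

text \<open>A Leibniz term of \<open>q\<close> survives only if each \<open>q i\<close> is
  \<open>i\<close> or \<open>p i\<close>. The set where \<open>q i = p i\<close> is invariant under
  \<open>p\<close>, so \<open>q\<close> is \<open>id\<close> or \<open>p\<close>, and the sign of
  \<open>p\<close> is read off from the vanishing at \<open>x = 1\<close>.\<close>

lemma perm_det_transitive:
  assumes p: "p permutes {..<n}" and n: "n > 0"
    and trans: "\<And>S. S \<subseteq> {..<n} \<Longrightarrow> S \<noteq> {} \<Longrightarrow> p ` S \<subseteq> S \<Longrightarrow> S = {..<n}"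
  shows "perm_det n p x = 1 - x ^ n"
\<comment> \<open>For \<open>n = 1\<close> the permutations \<open>id\<close> and \<open>p\<close>
  coincide, and the Leibniz sum has one term instead of two.\<close>
proof (cases "n = 1")
  case True
  have "p 0 = 0" using p True permutes_in_image[OF p, of 0] by simp
  then show ?thesis using True
    by (simp add: perm_det_def rdet_def det_single)
next
  case False
  have nofix: "p i \<noteq> i" if "i < n" for i
  proof
    assume "p i = i"
    then have "{i} = {..<n}" using that by (intro trans) auto
    then have "n = 1" by (metis card_lessThan is_singletonI is_singleton_altdef)
    with False show False by simp
  qed
  let ?c = "\<lambda>x i j. of_bool (i = j) - x * of_bool (p i = j) :: real"
  have zero: "(\<Prod>i = 0..<n. ?c x i (q i)) = 0" if q: "q permutes {0..<n}" "q \<noteq> id" "q \<noteq> p" for q x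
  proof (rule ccontr)
    assume "(\<Prod>i = 0..<n. ?c x i (q i)) \<noteq> 0"
    then have cases: "q i = i \<or> q i = p i" if "i < n" for i using that by force
    define S where "S = {i. i < n \<and> q i = p i}"
    have "p i \<in> S" if "i \<in> S" for i
    proof -
      have i: "i < n" "q i = p i" using that by (auto simp: S_def)
      then have pi: "p i < n" using permutes_in_image[OF p, of i] by simp
      \<comment> \<open>Otherwise \<open>q (p i) = p i = q i\<close>, and injectivity of
        \<open>q\<close> would make \<open>i\<close> a fixed point of \<open>p\<close>.\<close>
      have "q (p i) \<noteq> p i"
        using nofix[OF i(1)] i(2) permutes_inj[OF q(1)] by (metis injD)
      with cases[OF pi] pi show ?thesis by (auto simp: S_def)
    qed
    then have "S = {} \<or> S = {..<n}" using trans[of S] by (auto simp: S_def)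
    then show False
    proof
      assume "S = {}"
      then have "q i = i" for i
        using cases q(1) by (cases "i < n") (auto simp: S_def permutes_def)
      with q(2) show False by auto
    next
      assume "S = {..<n}"
      then have "q i = p i" for i
        using q(1) p by (cases "i < n") (auto simp: S_def permutes_def)
      with q(3) show False by auto
    qed
  qed
  have p': "p permutes {0..<n}" using p by (simp add: atLeast0LessThan)
  have ne: "id \<noteq> p" using nofix[of 0] n by auto
  have F: "perm_det n p x = 1 + of_int (sign p) * (- x) ^ n" for x
  proof -
    have "perm_det n p x =
      (\<Sum>q\<in>{id, p}. of_int (sign q) * (\<Prod>i = 0..<n. ?c x i (q i)))"
      unfolding perm_det_def rdet_leibniz
      by (rule sum.mono_neutral_right)
         (use zero p' permutes_id in \<open>auto intro!: finite_permutations\<close>)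
    also have "\<dots> = (\<Prod>i = 0..<n. ?c x i i) + of_int (sign p) * (\<Prod>i = 0..<n. ?c x i (p i))"
      using ne by (simp add: sign_id)
    also have "(\<Prod>i = 0..<n. ?c x i i) = (\<Prod>i = 0..<n. 1)"
      by (rule prod.cong) (use nofix in auto)
    also have "(\<Prod>i = 0..<n. ?c x i (p i)) = (\<Prod>i = 0..<n. - x)"
      by (rule prod.cong) (use nofix[symmetric] in auto)
    finally show ?thesis by simp
  qed
  \<comment> \<open>The whole vertex set is invariant, so a factor \<open>1 - x\<close> splits off;
    at \<open>x = 1\<close> this fixes the coefficient of \<open>x ^ n\<close>.\<close>
  have "perm_det n p 1 = 0"
    unfolding perm_det_def using n permutes_imp_bij[OF p]
    by (subst rdet_invariant_rows[of "{..<n}" n 0 p _ 1]) auto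
  then have "of_int (sign p) * (- 1) ^ n = (- 1 :: real)" using F[of 1] by simp
  then have "of_int (sign p) * (- x) ^ n = - (x ^ n)"
    using power_mult_distrib[of "-1" x n] by (metis mult.assoc mult_minus1)
  then show ?thesis using F by simp
qed

text \<open>As \<open>x\<close> tends to 1, the quotient of \<open>perm_det n p x\<close> by \<open>1 - x\<close> detects the long cycles.\<close>

lemma perm_det_quotient:
  assumes p: "p permutes {..<n}" and n: "n > 0"
  defines "tr \<equiv> \<forall>S. S \<subseteq> {..<n} \<and> S \<noteq> {} \<and> p ` S \<subseteq> S \<longrightarrow> S = {..<n}"
  shows "\<exists>H. isCont H 1 \<and> (\<forall>x. perm_det n p x = (1 - x) * H x) \<and> H 1 = (if tr then real n else 0)"
proof (cases tr)
  case True
  \<comment> \<open>The quotient is a geometric sum of \<open>n\<close> terms, each equal to 1 at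
    \<open>x = 1\<close>.\<close>
  show ?thesis
    by (rule exI[of _ "\<lambda>x. \<Sum>i<n. x ^ i"])
       (use True n in \<open>auto simp: tr_def perm_det_transitive[OF p] one_diff_power_eq intro!: continuous_intros\<close>)
next
  case False
  then obtain S where "S \<subset> {..<n}" "S \<noteq> {}" "p ` S \<subseteq> S" unfolding tr_def by blast
  from perm_det_intransitive[OF p this] obtain K
    where "isCont K 1" "\<And>x. perm_det n p x = (1 - x) * ((1 - x) * K x)" by blast
  \<comment> \<open>One of the two factors \<open>1 - x\<close> stays in the quotient and makes it
    vanish at 1.\<close>
  then show ?thesis
    by (intro exI[of _ "\<lambda>x. (1 - x) * K x"]) (use False in \<open>auto intro!: continuous_intros\<close>)
qed

subsection \<open>The heat kernel and its generator\<close>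

text \<open>The pair \<open>(j, i)\<close> with \<open>i < j\<close> stands for the edge joining \<open>i\<close> and \<open>j\<close>.\<close>

definition edges :: "nat \<Rightarrow> (nat \<times> nat) set" where
  "edges n = (SIGMA j:{1..n}. {1..<j})"

lemma edgesD:
  "(j, i) \<in> edges n \<Longrightarrow> 1 \<le> i \<and> i < j \<and> j \<le> n"
  by (auto simp: edges_def)

text \<open>The generator of the process: minus left multiplication by
  \<open>gr_laplacian n a\<close>, as \<open>gr_mult_laplacian\<close> confirms.\<close>

definition interchange_gen :: "nat \<Rightarrow> (nat \<Rightarrow> nat \<Rightarrow> real) \<Rightarrow> group_ring \<Rightarrow> group_ring" where
  "interchange_gen n a u g =
     (\<Sum>(j, i)\<in>edges n. a i j * (u (Transposition.transpose i j \<circ> g) - u g))"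

lemma transpose_in_Sym:
  assumes "(j, i) \<in> edges n"
  shows "Transposition.transpose i j \<in> Sym n"
  using edgesD[OF assms] by (auto simp: Sym_def intro!: permutes_swap_id)

lemma compose_in_Sym: "p \<in> Sym n \<Longrightarrow> q \<in> Sym n \<Longrightarrow> p \<circ> q \<in> Sym n"
  by (auto simp: Sym_def intro: permutes_compose)

lemma id_in_Sym: "id \<in> Sym n"
  by (simp add: Sym_def permutes_id)

text \<open>The Laplacian is supported on the identity and the transpositions, which are their own
  inverses, so the convolution collapses to these terms.\<close>

lemma gr_mult_laplacian:
  "gr_mult n (\<lambda>g. c * gr_laplacian n a g) u g = - c * interchange_gen n a u g"
proof -
  let ?s = "\<lambda>x. u (inv_into UNIV x \<circ> g)" and ?t = "Transposition.transpose"
  have lap: "gr_laplacian n a x = (\<Sum>(j, i)\<in>edges n. a i j * (gr_of id x - gr_of (?t i j) x))" for x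
    by (simp add: gr_laplacian_def edges_def sum.Sigma)
  have single: "(\<Sum>x\<in>Sym n. gr_of p x * ?s x) = ?s p" if "p \<in> Sym n" for p
    using that by (simp add: gr_of_def if_distrib[of "\<lambda>y. y * _"] finite_Sym cong: if_cong)
  have "gr_mult n (\<lambda>g. c * gr_laplacian n a g) u g =
      (\<Sum>x\<in>Sym n. \<Sum>(j, i)\<in>edges n. c * (a i j * (gr_of id x * ?s x - gr_of (?t i j) x * ?s x)))"
    unfolding gr_mult_def lap
    by (intro sum.cong refl) (simp add: sum_distrib_left sum_distrib_right case_prod_unfold algebra_simps)
  also have "\<dots> = (\<Sum>(j, i)\<in>edges n. \<Sum>x\<in>Sym n. c * (a i j * (gr_of id x * ?s x - gr_of (?t i j) x * ?s x)))"
    unfolding case_prod_unfold by (rule sum.swap)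
  also have "\<dots> = (\<Sum>(j, i)\<in>edges n. c * (a i j * (u g - u (?t i j \<circ> g))))"
  proof (rule sum.cong[OF refl], clarify)
    fix j i assume e: "(j, i) \<in> edges n"
    show "(\<Sum>x\<in>Sym n. c * (a i j * (gr_of id x * ?s x - gr_of (?t i j) x * ?s x))) =
        c * (a i j * (u g - u (?t i j \<circ> g)))"
      using single[OF id_in_Sym] single[OF transpose_in_Sym[OF e]]
      by (simp add: sum_distrib_left[symmetric] sum_subtractf)
  qed
  finally show ?thesis
    by (simp add: interchange_gen_def sum_distrib_left sum_negf[symmetric] case_prod_unfold algebra_simps)
qed

lemma gr_power_scale: "gr_power n (\<lambda>g. c * u g) k g = c ^ k * gr_power n u k g"
proof (induction k arbitrary: g)
  case 0
  then show ?case by (simp add: gr_power_def)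
next
  case (Suc k)
  have "gr_power n (\<lambda>g. c * u g) (Suc k) g =
      (\<Sum>x\<in>Sym n. c * u x * gr_power n (\<lambda>g. c * u g) k (inv_into UNIV x \<circ> g))"
    by (simp add: gr_power_def gr_mult_def)
  also have "\<dots> = c ^ Suc k * gr_power n u (Suc k) g"
    unfolding Suc by (simp add: gr_power_def gr_mult_def sum_distrib_left mult_ac)
  finally show ?case .
qed

text \<open>At fixed \<open>g\<close> the kernel is an everywhere convergent power series in
  \<open>t\<close>. Termwise differentiation shifts its coefficients, and one shift is one
  application of the generator.\<close>

lemma heat_kernel_deriv:
  "((\<lambda>t. heat_kernel n a t g) has_field_derivative interchange_gen n a (heat_kernel n a t) g) (at t)"
proof -
  define b where "b = gr_power n (\<lambda>g. - 1 * gr_laplacian n a g)"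
  have b_Suc: "b (Suc k) g = interchange_gen n a (b k) g" for k g
    using gr_mult_laplacian[where c = "-1"] by (simp add: b_def gr_power_def)
  have pow: "gr_power n (\<lambda>g. - t * gr_laplacian n a g) k g / fact k = b k g / fact k * t ^ k" for t k g
    using gr_power_scale[of n t "\<lambda>g. - 1 * gr_laplacian n a g" k g] by (simp add: b_def)
  have summ: "summable (\<lambda>k. b k g / fact k * t ^ k)" for t g
    using summable_rabs_cancel[OF summable_gr_exp[of n "\<lambda>g. - t * gr_laplacian n a g" g]]
    unfolding pow .
  have hk: "heat_kernel n a t g = (\<Sum>k. b k g / fact k * t ^ k)" for t g
    unfolding heat_kernel_def gr_exp_def pow ..
  have sms: "(\<lambda>k. b k g / fact k * t ^ k) sums heat_kernel n a t g" for g
    unfolding hk using summ by (rule summable_sums)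
  \<comment> \<open>The generator is a finite linear combination of values, so it can be applied to
    the series term by term.\<close>
  have "(\<lambda>k. \<Sum>(j, i)\<in>edges n. a i j * (b k (Transposition.transpose i j \<circ> g) / fact k * t ^ k
      - b k g / fact k * t ^ k)) sums interchange_gen n a (heat_kernel n a t) g"
    unfolding interchange_gen_def case_prod_unfold
    by (intro sums_sum sums_mult sums_diff sms)
  also have "(\<lambda>k. \<Sum>(j, i)\<in>edges n. a i j * (b k (Transposition.transpose i j \<circ> g) / fact k * t ^ k
      - b k g / fact k * t ^ k)) = (\<lambda>k. diffs (\<lambda>k. b k g / fact k) k * t ^ k)"
  proof (rule ext)
    fix k
    have "diffs (\<lambda>k. b k g / fact k) k = interchange_gen n a (b k) g / fact k"
      by (simp add: diffs_def b_Suc del: of_nat_Suc)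
    then show "(\<Sum>(j, i)\<in>edges n. a i j * (b k (Transposition.transpose i j \<circ> g) / fact k * t ^ k
      - b k g / fact k * t ^ k)) = diffs (\<lambda>k. b k g / fact k) k * t ^ k"
      by (simp add: interchange_gen_def sum_divide_distrib sum_distrib_left sum_distrib_right
          case_prod_unfold diff_divide_distrib algebra_simps)
  qed
  finally have "(\<Sum>k. diffs (\<lambda>k. b k g / fact k) k * t ^ k) = interchange_gen n a (heat_kernel n a t) g"
    by (simp add: sums_iff)
  with termdiffs_strong_converges_everywhere[OF summ[of g], of t] show ?thesis
    unfolding hk[abs_def] by simp
qed

lemma heat_kernel_0: "heat_kernel n a 0 = gr_of id"
proof
  fix g
  have "gr_power n (\<lambda>g. - 0 * gr_laplacian n a g) k g / fact k = gr_of id g * (if k = 0 then 1 else 0)" for k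
    using gr_power_scale[of n 0 "gr_laplacian n a" k g] by (simp add: gr_power_def)
  then show "heat_kernel n a 0 g = gr_of id g"
    unfolding heat_kernel_def gr_exp_def using suminf_finite[of "{0}" "\<lambda>k. gr_of id g * (if k = 0 then 1 else 0)"] by simp
qed

text \<open>Left multiplication by a transposition is an involution of \<open>Sym n\<close>;
  reindexing by it makes every edge term self-adjoint.\<close>

lemma interchange_gen_symmetric:
  "(\<Sum>g\<in>Sym n. v g * interchange_gen n a u g) = (\<Sum>g\<in>Sym n. interchange_gen n a v g * u g)"
proof -
  have re: "(\<Sum>g\<in>Sym n. v g * u (Transposition.transpose i j \<circ> g)) =
      (\<Sum>g\<in>Sym n. v (Transposition.transpose i j \<circ> g) * u g)" if e: "(j, i) \<in> edges n" for i j
    by (rule sum.reindex_bij_witness[where i = "\<lambda>g. Transposition.transpose i j \<circ> g"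
          and j = "\<lambda>g. Transposition.transpose i j \<circ> g"])
       (simp_all add: compose_in_Sym[OF transpose_in_Sym[OF e]] comp_assoc[symmetric])
  have "(\<Sum>g\<in>Sym n. v g * interchange_gen n a u g) =
      (\<Sum>(j, i)\<in>edges n. a i j * ((\<Sum>g\<in>Sym n. v g * u (Transposition.transpose i j \<circ> g)) - (\<Sum>g\<in>Sym n. v g * u g)))"
    unfolding interchange_gen_def case_prod_unfold sum_distrib_left
    by (subst sum.swap) (simp add: sum_distrib_left sum_subtractf[symmetric] algebra_simps)
  also have "\<dots> = (\<Sum>(j, i)\<in>edges n. a i j * ((\<Sum>g\<in>Sym n. v (Transposition.transpose i j \<circ> g) * u g) - (\<Sum>g\<in>Sym n. v g * u g)))"
    by (rule sum.cong) (auto simp: re)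
  also have "\<dots> = (\<Sum>g\<in>Sym n. interchange_gen n a v g * u g)"
    unfolding interchange_gen_def case_prod_unfold sum_distrib_right
    by (subst sum.swap[where A = "Sym n" and B = "edges n"]) (simp add: sum_distrib_left sum_subtractf[symmetric] algebra_simps)
  finally show ?thesis .
qed

text \<open>Duhamel: along a solution \<open>u\<close> of the backward equation, the pairing of \<open>u (t - s)\<close> with
  the heat kernel at time \<open>s\<close> does not depend on \<open>s\<close>.\<close>

lemma heat_kernel_pairing:
  assumes "\<And>g t. g \<in> Sym n \<Longrightarrow>
    ((\<lambda>t. u t g) has_field_derivative interchange_gen n a (u t) g) (at t)"
  shows "(\<Sum>g\<in>Sym n. heat_kernel n a t g * u 0 g) = u t id"
proof -
  let ?f = "\<lambda>s. \<Sum>g\<in>Sym n. heat_kernel n a s g * u (t - s) g"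
  have "(?f has_field_derivative 0) (at s)" for s
  proof -
    \<comment> \<open>The two parts of the product rule have opposite signs and cancel by symmetry
      of the generator.\<close>
    have "(?f has_field_derivative (\<Sum>g\<in>Sym n.
        interchange_gen n a (heat_kernel n a s) g * u (t - s) g +
        (interchange_gen n a (u (t - s)) g * (0 - 1)) * heat_kernel n a s g)) (at s)"
      by (intro DERIV_sum DERIV_mult heat_kernel_deriv DERIV_chain2[OF assms]
          DERIV_diff DERIV_const DERIV_ident)
    also have "(\<Sum>g\<in>Sym n.
        interchange_gen n a (heat_kernel n a s) g * u (t - s) g +
        (interchange_gen n a (u (t - s)) g * (0 - 1)) * heat_kernel n a s g) = 0"
      using interchange_gen_symmetric[where v = "heat_kernel n a s" and u = "u (t - s)"]
      by (simp add: sum_subtractf mult.commute)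
    finally show ?thesis .
  qed
  \<comment> \<open>At \<open>s = t\<close> the pairing is with \<open>u 0\<close>; at
    \<open>s = 0\<close> the kernel is the unit mass at the identity, which evaluates
    \<open>u t\<close> there.\<close>
  then have "?f t = ?f 0" using DERIV_isconst_all by blast
  also have "?f 0 = (\<Sum>g\<in>Sym n. if g = id then u t g else 0)"
    by (rule sum.cong) (auto simp: heat_kernel_0 gr_of_def)
  also have "\<dots> = u t id" using finite_Sym id_in_Sym by simp
  finally show ?thesis by simp
qed

text \<open>This is \<open>det (1 - x * P g * e)\<close>. The rows of \<open>e\<close> are indexed
  by vertices from 1, its columns from 0.\<close>

definition moved_det :: "nat \<Rightarrow> (nat \<Rightarrow> nat \<Rightarrow> real) \<Rightarrow> real \<Rightarrow> group_ring" where
  "moved_det n e x g = rdet n (\<lambda>r s. of_bool (r = s) - x * e (g (Suc r)) s)"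

text \<open>Composing with the transposition exchanges the rows \<open>e i\<close> and
  \<open>e j\<close> at the two positions that \<open>g\<close> sends to \<open>i\<close> and
  \<open>j\<close>. This is a rank one change, so the increment equals the directional derivative on
  the right.\<close>

lemma moved_det_transpose:
  fixes e :: "nat \<Rightarrow> nat \<Rightarrow> real" and x :: real
  assumes ed: "(j, i) \<in> edges n" and g: "g \<in> Sym n"
  defines "f \<equiv> (\<lambda>r s. of_bool (r = s) - x * e (g (Suc r)) s)"
  shows "moved_det n e x (Transposition.transpose i j \<circ> g) - moved_det n e x g =
    (\<Sum>k<n. rdet n (f(k := (\<lambda>s. x * (of_bool (g (Suc k) = i) - of_bool (g (Suc k) = j)) * (e i s - e j s)))))"
proof -
  have perm: "g permutes {1..n}" using g by (simp add: Sym_def)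
  have ex: "\<exists>p<n. g (Suc p) = v" if "v \<in> {1..n}" for v
  proof -
    from that permutes_image[OF perm] obtain w where "w \<in> {1..n}" "v = g w" by (metis imageE)
    then show ?thesis by (intro exI[of _ "w - 1"]) auto
  qed
  have ij: "i \<in> {1..n}" "j \<in> {1..n}" "i \<noteq> j" using edgesD[OF ed] by auto
  obtain p q where p: "p < n" "g (Suc p) = i" and q: "q < n" "g (Suc q) = j"
    using ex ij by metis
  have gp: "g (Suc r) = i \<longleftrightarrow> r = p" "g (Suc r) = j \<longleftrightarrow> r = q" for r
    using permutes_inj[OF perm] p q by (metis injD nat.inject)+
  have "p \<noteq> q" using p q ij by auto
  let ?r = "\<lambda>s. x * (e i s - e j s)"
  let ?h = "\<lambda>k s. if k = p then ?r s else if k = q then - ?r s else 0"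
  have "moved_det n e x (Transposition.transpose i j \<circ> g) = rdet n (\<lambda>k s. f k s + ?h k s)"
    unfolding moved_det_def f_def
  proof (rule rdet_cong)
    fix k s
    consider "k = p" | "k = q" | "k \<noteq> p" "k \<noteq> q" by blast
    then show "of_bool (k = s) - x * e ((Transposition.transpose i j \<circ> g) (Suc k)) s =
        of_bool (k = s) - x * e (g (Suc k)) s + ?h k s"
    proof cases
      case 3
      then show ?thesis using gp[of k] by (simp add: Transposition.transpose_def)
    qed (use \<open>p \<noteq> q\<close> in \<open>simp_all add: p(2) q(2) algebra_simps\<close>)
  qed
  moreover have "moved_det n e x g = rdet n f" by (simp add: moved_det_def f_def)
  moreover have "?h k = (\<lambda>s. x * (of_bool (g (Suc k) = i) - of_bool (g (Suc k) = j)) * (e i s - e j s))" for k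
    using gp[of k] \<open>p \<noteq> q\<close> by (auto simp: fun_eq_iff)
  ultimately show ?thesis
    using rdet_rank_one_increment[OF \<open>p \<noteq> q\<close> p(1) q(1), of f ?r] by simp
qed

text \<open>The hypothesis is the heat equation for \<open>e\<close>, with the Laplacian split into
  edges. The velocity of the matrix is thus a weighted sum of the directions in
  \<open>moved_det_transpose\<close>, and the derivative of the determinant is linear in the
  direction.\<close>

lemma moved_det_deriv:
  assumes e: "\<And>v s. v \<in> {1..n} \<Longrightarrow> s < n \<Longrightarrow> ((\<lambda>t. e t v s) has_field_derivative
      (\<Sum>(j, i)\<in>edges n. a i j * ((of_bool (v = j) - of_bool (v = i)) * (e t i s - e t j s)))) (at t)"
    and g: "g \<in> Sym n"
  shows "((\<lambda>t. moved_det n (e t) x g) has_field_derivative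
    interchange_gen n a (moved_det n (e t) x) g) (at t)"
proof -
  define f where "f = (\<lambda>r s. of_bool (r = s) - x * e t (g (Suc r)) s)"
  define H where "H = (\<lambda>(j, i) k s. x * (of_bool (g (Suc k) = i) - of_bool (g (Suc k) = j)) * (e t i s - e t j s))"
  define c where "c = (\<lambda>(j, i). a i j)"
  define h where "h = (\<lambda>k s. \<Sum>d\<in>edges n. c d * H d k s)"
  have "((\<lambda>t. moved_det n (e t) x g) has_field_derivative (\<Sum>k<n. rdet n (f(k := h k)))) (at t)"
    unfolding moved_det_def f_def
  proof (rule has_derivative_rdet)
    fix r s assume rs: "r < n" "s < n"
    have v: "g (Suc r) \<in> {1..n}"
      using g rs permutes_in_image[of g "{1..n}" "Suc r"] by (simp add: Sym_def)
    have "h r s = 0 - x * (\<Sum>(j, i)\<in>edges n. a i j * ((of_bool (g (Suc r) = j) - of_bool (g (Suc r) = i)) * (e t i s - e t j s)))"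
      by (simp add: h_def c_def H_def sum_distrib_left sum_negf[symmetric] case_prod_unfold algebra_simps)
    then show "((\<lambda>t. of_bool (r = s) - x * e t (g (Suc r)) s) has_field_derivative h r s) (at t)"
      by (simp only:) (intro DERIV_diff DERIV_const DERIV_cmult e[OF v rs(2)])
  qed
  also have "(\<Sum>k<n. rdet n (f(k := h k))) = (\<Sum>k<n. \<Sum>d\<in>edges n. c d * rdet n (f(k := H d k)))"
    unfolding h_def by (intro sum.cong refl rdet_row_sum) simp
  also have "\<dots> = (\<Sum>d\<in>edges n. c d * (\<Sum>k<n. rdet n (f(k := H d k))))"
    by (subst sum.swap) (simp add: sum_distrib_left)
  also have "\<dots> = interchange_gen n a (moved_det n (e t) x) g"
    unfolding interchange_gen_def
    by (rule sum.cong) (auto simp: c_def H_def f_def moved_det_transpose[OF _ g])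
  finally show ?thesis .
qed

subsection \<open>Matrix exponentials\<close>

primrec mpow :: "nat \<Rightarrow> (nat \<Rightarrow> nat \<Rightarrow> real) \<Rightarrow> nat \<Rightarrow> nat \<Rightarrow> nat \<Rightarrow> real" where
  "mpow n B 0 = (\<lambda>i j. of_bool (i = j))"
| "mpow n B (Suc k) = (\<lambda>i j. \<Sum>l<n. B i l * mpow n B k l j)"

text \<open>The entry of \<open>exp (t * B)\<close>, taken as a real power series so that termwise
  differentiation applies to each entry.\<close>

definition mexp :: "nat \<Rightarrow> (nat \<Rightarrow> nat \<Rightarrow> real) \<Rightarrow> real \<Rightarrow> nat \<Rightarrow> nat \<Rightarrow> real" where
  "mexp n B t i j = (\<Sum>k. mpow n B k i j / fact k * t ^ k)"

lemma mpow_bound: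
  assumes "\<And>i l. i < n \<Longrightarrow> l < n \<Longrightarrow> \<bar>B i l\<bar> \<le> c" "i < n"
  shows "\<bar>mpow n B k i j\<bar> \<le> (real n * c) ^ k"
  using assms(2)
proof (induction k arbitrary: i)
  case 0
  show ?case by simp
next
  case (Suc k)
  have c: "0 \<le> c" using assms(1)[OF Suc.prems Suc.prems] by linarith
  have "\<bar>mpow n B (Suc k) i j\<bar> \<le> (\<Sum>l<n. \<bar>B i l\<bar> * \<bar>mpow n B k l j\<bar>)"
    by (simp add: sum_abs[THEN order_trans] abs_mult)
  also have "\<dots> \<le> (\<Sum>l<n. c * (real n * c) ^ k)"
    using c Suc assms(1) by (intro sum_mono mult_mono) auto
  finally show ?case by (simp add: mult_ac)
qed

lemma mexp_sums:
  assumes "i < n"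
  shows "(\<lambda>k. mpow n B k i j / fact k * t ^ k) sums mexp n B t i j"
proof -
  define c where "c = (\<Sum>i<n. \<Sum>l<n. \<bar>B i l\<bar>)"
  have c: "\<bar>B i l\<bar> \<le> c" if "i < n" "l < n" for i l
  proof -
    have "\<bar>B i l\<bar> \<le> (\<Sum>l<n. \<bar>B i l\<bar>)" by (rule member_le_sum) (use that in auto)
    also have "\<dots> \<le> c" unfolding c_def
      by (rule member_le_sum[where f = "\<lambda>i. \<Sum>l<n. \<bar>B i l\<bar>"]) (use that in \<open>auto intro: sum_nonneg\<close>)
    finally show ?thesis .
  qed
  have "summable (\<lambda>k. mpow n B k i j / fact k * t ^ k)"
  proof (rule summable_comparison_test'[where N = 0])
    show "summable (\<lambda>k. (real n * c * \<bar>t\<bar>) ^ k / fact k)"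
      using summable_exp[of "real n * c * \<bar>t\<bar>"] by (simp add: field_simps)
    show "norm (mpow n B k i j / fact k * t ^ k) \<le> (real n * c * \<bar>t\<bar>) ^ k / fact k" for k
      using mult_right_mono[OF mpow_bound[where B = B and c = c and k = k and j = j, OF c assms],
          of "\<bar>t\<bar> ^ k"]
      by (simp add: abs_mult power_abs power_mult_distrib[symmetric] divide_right_mono)
  qed
  then show ?thesis unfolding mexp_def by (rule summable_sums)
qed

lemma mexp_deriv:
  assumes "i < n"
  shows "((\<lambda>t. mexp n B t i j) has_field_derivative (\<Sum>l<n. B i l * mexp n B t l j)) (at t)"
proof -
  have "(\<lambda>k. \<Sum>l<n. B i l * (mpow n B k l j / fact k * t ^ k)) sums (\<Sum>l<n. B i l * mexp n B t l j)"
    by (intro sums_sum sums_mult mexp_sums) simp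
  also have "(\<lambda>k. \<Sum>l<n. B i l * (mpow n B k l j / fact k * t ^ k)) =
      (\<lambda>k. diffs (\<lambda>k. mpow n B k i j / fact k) k * t ^ k)"
    by (rule ext) (simp add: diffs_def sum_divide_distrib sum_distrib_left sum_distrib_right
        mult_ac del: of_nat_Suc)
  finally have "(\<Sum>k. diffs (\<lambda>k. mpow n B k i j / fact k) k * t ^ k) = (\<Sum>l<n. B i l * mexp n B t l j)"
    by (simp add: sums_iff)
  with termdiffs_strong_converges_everywhere[OF sums_summable[OF mexp_sums[OF assms, of B j]], of t]
  show ?thesis unfolding mexp_def[abs_def] by simp
qed

lemma mexp_0: "mexp n B 0 i j = of_bool (i = j)"
  unfolding mexp_def by (subst suminf_finite[of "{0}"]) auto

text \<open>Powers of an upper triangular matrix are upper triangular, and their diagonal entries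
  are the powers of the diagonal entries.\<close>

lemma mexp_upper_triangular:
  assumes B: "\<And>i j. j < i \<Longrightarrow> i < n \<Longrightarrow> B i j = 0" and "i < n"
  shows "j < i \<Longrightarrow> mexp n B t i j = 0" "mexp n B t i i = exp (t * B i i)"
proof -
  have low: "j < i \<Longrightarrow> i < n \<Longrightarrow> mpow n B k i j = 0" for i j k
  proof (induction k arbitrary: i)
    case (Suc k)
    \<comment> \<open>For \<open>l < i\<close> the first factor vanishes; otherwise
      \<open>j < i \<le> l\<close> and the second one does by induction.\<close>
    have "B i l * mpow n B k l j = 0" if "l < n" for l
      using B[of l i] Suc that by (cases "l < i") auto
    then show ?case by (simp add: sum.neutral)
  qed simp
  then show "j < i \<Longrightarrow> mexp n B t i j = 0"
    using assms(2) by (simp add: mexp_def)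
  have diag: "mpow n B k i i = B i i ^ k" for k
  proof (induction k)
    case (Suc k)
    have "(\<Sum>l<n. B i l * mpow n B k l i) = (\<Sum>l\<in>{i}. B i l * mpow n B k l i)"
    proof (rule sum.mono_neutral_right)
      show "\<forall>l\<in>{..<n} - {i}. B i l * mpow n B k l i = 0"
      proof
        fix l assume "l \<in> {..<n} - {i}"
        then show "B i l * mpow n B k l i = 0"
          using B[of l i] low[of i l k] assms(2) by (cases "l < i") auto
      qed
    qed (use assms(2) in auto)
    with Suc show ?case by simp
  qed simp
  show "mexp n B t i i = exp (t * B i i)"
    unfolding mexp_def diag exp_def by (simp add: field_simps scaleR_conv_of_real power_mult_distrib)
qed

text \<open>A Schur form reduces the exponential of a matrix with split characteristic polynomial to
  that of a triangular matrix, so that no diagonalization is needed.\<close>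

lemma semigroup_exists:
  fixes A :: "real mat"
  assumes A: "A \<in> carrier_mat n n" and cp: "char_poly A = (\<Prod>i<n. [:- ev i, 1:])"
  obtains E where
    "\<And>t i j. i < n \<Longrightarrow> j < n \<Longrightarrow>
      ((\<lambda>t. E t i j) has_field_derivative - (\<Sum>k<n. A $$ (i, k) * E t k j)) (at t)"
    "\<And>i j. i < n \<Longrightarrow> j < n \<Longrightarrow> E 0 i j = of_bool (i = j)"
    "\<And>t x. rdet n (\<lambda>i j. of_bool (i = j) - x * E t i j) = (\<Prod>i<n. 1 - x * exp (- ev i * t))"
proof -
  let ?es = "map ev [0..<n]"
  obtain B P Q where BPQ: "schur_decomposition A ?es = (B, P, Q)"
    by (cases "schur_decomposition A ?es") auto
  have "char_poly A = (\<Prod>e\<leftarrow>?es. [:- e, 1:])"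
    unfolding cp by (simp add: prod.list_conv_set_nth atLeast0LessThan)
  from schur_decomposition[OF A this BPQ]
  have wit: "similar_mat_wit A B P Q" and ut: "upper_triangular B" and diag: "diag_mat B = ?es"
    by auto
  note wit = similar_mat_witD2[OF A wit]
  have carr: "B \<in> carrier_mat n n" "P \<in> carrier_mat n n" "Q \<in> carrier_mat n n" using wit by auto
  have Bii: "B $$ (i, i) = ev i" if "i < n" for i
    using arg_cong[OF diag, of "\<lambda>l. l ! i"] that carr by (simp add: diag_mat_def)
  let ?B = "\<lambda>i j. B $$ (i, j)"
  have low: "?B i j = 0" if "j < i" "i < n" for i j
    using ut that carr by auto
  \<comment> \<open>\<open>T t\<close> is \<open>exp (- t * B)\<close> for the Schur form
    \<open>B\<close>, and conjugating back gives \<open>E t = exp (- t * A)\<close>.\<close>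
  define T where "T t = mat n n (\<lambda>(i, j). mexp n ?B (- t) i j)" for t
  define E where "E t = (\<lambda>i j. (P * T t * Q) $$ (i, j))" for t
  have T: "T t \<in> carrier_mat n n" for t by (simp add: T_def)
  \<comment> \<open>This turns the factor \<open>B\<close> produced by differentiating
    \<open>T\<close> into a factor \<open>A\<close> on the left of \<open>E\<close>.\<close>
  have AP: "A * P = P * B"
  proof -
    have "A * P = P * B * (Q * P)" using wit carr by (simp add: assoc_mult_mat[of _ n n _ n _ n])
    also have "\<dots> = P * B" using wit carr by simp
    finally show ?thesis .
  qed
  have Ent: "(M * T t * Q) $$ (i, j) = (\<Sum>q<n. (\<Sum>p<n. M $$ (i, p) * mexp n ?B (- t) p q) * Q $$ (q, j))"
    if "i < n" "j < n" "M \<in> carrier_mat n n" for i j t M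
    using that carr by (simp add: T_def scalar_prod_def atLeast0LessThan)
  show ?thesis
  proof (rule that[of E])
    fix t i j assume ij: "i < n" "j < n"
    have "((\<lambda>t. E t i j) has_field_derivative
        (\<Sum>q<n. (\<Sum>p<n. P $$ (i, p) * ((\<Sum>l<n. ?B p l * mexp n ?B (- t) l q) * - 1)) * Q $$ (q, j))) (at t)"
      unfolding E_def Ent[OF ij carr(2)]
      by (intro DERIV_sum DERIV_cmult DERIV_cmult_right DERIV_chain2[OF mexp_deriv] DERIV_minus DERIV_ident) auto
    also have "(\<Sum>q<n. (\<Sum>p<n. P $$ (i, p) * ((\<Sum>l<n. ?B p l * mexp n ?B (- t) l q) * - 1)) * Q $$ (q, j))
        = - (\<Sum>q<n. (\<Sum>l<n. (P * B) $$ (i, l) * mexp n ?B (- t) l q) * Q $$ (q, j))"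
    proof -
      have "(\<Sum>p<n. P $$ (i, p) * ((\<Sum>l<n. ?B p l * mexp n ?B (- t) l q) * - 1)) =
          - (\<Sum>l<n. (P * B) $$ (i, l) * mexp n ?B (- t) l q)" for q
      proof -
        have "(\<Sum>l<n. (P * B) $$ (i, l) * mexp n ?B (- t) l q) =
            (\<Sum>l<n. \<Sum>p<n. P $$ (i, p) * ?B p l * mexp n ?B (- t) l q)"
          using ij carr by (simp add: scalar_prod_def atLeast0LessThan sum_distrib_right)
        also have "\<dots> = (\<Sum>p<n. \<Sum>l<n. P $$ (i, p) * ?B p l * mexp n ?B (- t) l q)"
          by (rule sum.swap)
        finally show ?thesis by (simp add: sum_distrib_left sum_negf mult_ac)
      qed
      then show ?thesis by (simp add: sum_negf)
    qed
    also have "(\<Sum>q<n. (\<Sum>l<n. (P * B) $$ (i, l) * mexp n ?B (- t) l q) * Q $$ (q, j)) = (P * B * T t * Q) $$ (i, j)"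
      using carr by (subst Ent[OF ij]) auto
    also have "P * B * T t * Q = A * (P * T t * Q)"
      unfolding AP[symmetric] using A T[of t] carr by (simp add: assoc_mult_mat[of _ n n _ n _ n])
    also have "(A * (P * T t * Q)) $$ (i, j) = (\<Sum>k<n. A $$ (i, k) * E t k j)"
      using A T[of t] carr ij by (simp add: E_def scalar_prod_def[of "row A i"] atLeast0LessThan)
    finally show "((\<lambda>t. E t i j) has_field_derivative - (\<Sum>k<n. A $$ (i, k) * E t k j)) (at t)" .
  next
    fix i j assume ij: "i < n" "j < n"
    have "T 0 = 1\<^sub>m n" by (rule eq_matI) (auto simp: T_def mexp_0)
    then have "P * T 0 * Q = 1\<^sub>m n" using wit carr by simp
    then show "E 0 i j = of_bool (i = j)" using ij by (simp add: E_def)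
  next
    fix t x
    define M where "M = 1\<^sub>m n - x \<cdot>\<^sub>m T t"
    have M: "M \<in> carrier_mat n n" unfolding M_def using T[of t] by (intro minus_carrier_mat) auto
    \<comment> \<open>So \<open>1 - x * E t\<close> is similar to the triangular matrix
      \<open>M\<close>, whose determinant is the product of its diagonal.\<close>
    have "P * M * Q = 1\<^sub>m n - x \<cdot>\<^sub>m (P * T t * Q)"
    proof -
      have "P * M = P - x \<cdot>\<^sub>m (P * T t)"
        unfolding M_def using carr T[of t]
        by (simp add: mult_minus_distrib_mat[of _ n n _ n] mult_smult_distrib[of _ n n _ n])
      then have "P * M * Q = P * Q - (x \<cdot>\<^sub>m (P * T t)) * Q"
        using carr T[of t] by (simp add: minus_mult_distrib_mat[of _ n n _ _ n])
      also have "(x \<cdot>\<^sub>m (P * T t)) * Q = x \<cdot>\<^sub>m (P * T t * Q)"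
        using carr T[of t] by (intro mult_smult_assoc_mat[of _ n n _ n]) auto
      finally show ?thesis using wit by simp
    qed
    moreover have "mat n n (\<lambda>(i, j). of_bool (i = j) - x * E t i j) = 1\<^sub>m n - x \<cdot>\<^sub>m (P * T t * Q)"
      by (rule eq_matI) (use carr T[of t] in \<open>auto simp: E_def simp del: index_mult_mat(1)\<close>)
    ultimately have "mat n n (\<lambda>(i, j). of_bool (i = j) - x * E t i j) = P * M * Q" by simp
    then have "similar_mat (mat n n (\<lambda>(i, j). of_bool (i = j) - x * E t i j)) M"
      unfolding similar_mat_def similar_mat_wit_def Let_def
      using wit carr M by (intro exI[of _ P] exI[of _ Q]) auto
    then have "rdet n (\<lambda>i j. of_bool (i = j) - x * E t i j) = det M"
      unfolding rdet_def by (rule det_similar)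
    also have "\<dots> = prod_list (diag_mat M)"
      by (rule det_upper_triangular[OF _ M])
         (use low mexp_upper_triangular(1)[of n ?B] in \<open>auto simp: M_def T_def\<close>)
    also have "\<dots> = (\<Prod>i<n. M $$ (i, i))"
      using M by (simp add: diag_mat_def prod.list_conv_set_nth atLeast0LessThan)
    also have "\<dots> = (\<Prod>i<n. 1 - x * exp (- ev i * t))"
      by (rule prod.cong)
         (use low mexp_upper_triangular(2)[of n ?B] Bii in \<open>auto simp: M_def T_def mult.commute\<close>)
    finally show "rdet n (\<lambda>i j. of_bool (i = j) - x * E t i j) = (\<Prod>i<n. 1 - x * exp (- ev i * t))" .
  qed
qed

subsection \<open>The graph Laplacian\<close>

unbundle no vec_syntax

lemma graph_laplacian_row:
  assumes "r < n"
  shows "(\<Sum>k<n. graph_laplacian n a $$ (r, k) * f k) =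
    (\<Sum>j\<in>{1..n} - {Suc r}. a (Suc r) j * (f r - f (j - 1)))"
proof -
  have img: "{1..n} - {Suc r} = Suc ` ({..<n} - {r})"
  proof (intro equalityI subsetI)
    fix v assume "v \<in> {1..n} - {Suc r}"
    then show "v \<in> Suc ` ({..<n} - {r})" by (cases v) auto
  qed auto
  have "(\<Sum>k<n. graph_laplacian n a $$ (r, k) * f k) =
      graph_laplacian n a $$ (r, r) * f r + (\<Sum>k\<in>{..<n} - {r}. graph_laplacian n a $$ (r, k) * f k)"
    by (rule sum.remove) (use assms in auto)
  also have "(\<Sum>k\<in>{..<n} - {r}. graph_laplacian n a $$ (r, k) * f k) =
      (\<Sum>k\<in>{..<n} - {r}. - (a (Suc r) (Suc k) * f k))"
    by (rule sum.cong) (use assms in \<open>auto simp: graph_laplacian_def\<close>)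
  also have "\<dots> = - (\<Sum>j\<in>{1..n} - {Suc r}. a (Suc r) j * f (j - 1))"
    unfolding img by (subst sum.reindex) (auto simp: sum_negf)
  finally show ?thesis
    using assms by (simp add: graph_laplacian_def sum_distrib_right sum_subtractf right_diff_distrib)
qed

text \<open>Puts the heat equation into the edge form required by \<open>moved_det_deriv\<close>.
  The edges at the vertex \<open>Suc r\<close> split according to whether it is the larger or the
  smaller endpoint; symmetry of the weights merges both cases.\<close>

lemma graph_laplacian_row_edges:
  assumes "weighted_graph n a" "r < n"
  shows "- (\<Sum>k<n. graph_laplacian n a $$ (r, k) * f k) =
    (\<Sum>(j, i)\<in>edges n. a i j * ((of_bool (Suc r = j) - of_bool (Suc r = i)) * (f (i - 1) - f (j - 1))))"
proof -
  let ?v = "Suc r" and ?d = "\<lambda>i j. f (i - 1) - f (j - 1)"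
  have v: "?v \<in> {1..n}" using assms by auto
  have sym: "a j ?v = a ?v j" if "j \<in> {1..n}" "j \<noteq> ?v" for j
    using assms(1) v that unfolding weighted_graph_def by metis
  have "(\<Sum>(j, i)\<in>edges n. a i j * ((of_bool (?v = j) - of_bool (?v = i)) * ?d i j)) =
      (\<Sum>j\<in>{1..n}. \<Sum>i\<in>{1..<j}. of_bool (?v = j) * (a i j * ?d i j)) -
      (\<Sum>j\<in>{1..n}. \<Sum>i\<in>{1..<j}. of_bool (?v = i) * (a i j * ?d i j))"
    by (simp add: edges_def sum.Sigma[symmetric] sum_subtractf[symmetric] algebra_simps)
  \<comment> \<open>Edges whose larger endpoint is the given vertex.\<close>
  also have "(\<Sum>j\<in>{1..n}. \<Sum>i\<in>{1..<j}. of_bool (?v = j) * (a i j * ?d i j)) =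
      (\<Sum>j\<in>{1..n}. if ?v = j then \<Sum>i\<in>{1..<?v}. a i ?v * ?d i ?v else 0)"
    by (rule sum.cong) auto
  also have "\<dots> = (\<Sum>i\<in>{1..<?v}. a i ?v * ?d i ?v)" using v by simp
  also have "\<dots> = - (\<Sum>j\<in>{1..<?v}. a ?v j * (f r - f (j - 1)))"
    unfolding sum_negf[symmetric] using v sym
    by (intro sum.cong refl) (auto simp: algebra_simps)
  \<comment> \<open>Edges whose smaller endpoint is the given vertex.\<close>
  also have "(\<Sum>j\<in>{1..n}. \<Sum>i\<in>{1..<j}. of_bool (?v = i) * (a i j * ?d i j)) =
      (\<Sum>j\<in>{1..n}. if ?v < j then a ?v j * ?d ?v j else 0)"
  proof (rule sum.cong[OF refl])
    fix j
    have "(\<Sum>i\<in>{1..<j}. of_bool (?v = i) * (a i j * ?d i j)) =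
        (\<Sum>i\<in>{1..<j}. if ?v = i then a ?v j * ?d ?v j else 0)"
      by (rule sum.cong) auto
    then show "(\<Sum>i\<in>{1..<j}. of_bool (?v = i) * (a i j * ?d i j)) = (if ?v < j then a ?v j * ?d ?v j else 0)"
      by simp
  qed
  also have "\<dots> = (\<Sum>j\<in>{Suc ?v..n}. a ?v j * (f r - f (j - 1)))"
    by (rule sum.mono_neutral_cong_right) auto
  also have "- (\<Sum>j\<in>{1..<?v}. a ?v j * (f r - f (j - 1))) - (\<Sum>j\<in>{Suc ?v..n}. a ?v j * (f r - f (j - 1)))
      = - (\<Sum>j\<in>{1..<?v} \<union> {Suc ?v..n}. a ?v j * (f r - f (j - 1)))"
    by (subst sum.union_disjoint) auto
  also have "{1..<?v} \<union> {Suc ?v..n} = {1..n} - {?v}" using v by auto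
  finally show ?thesis by (simp add: graph_laplacian_row[OF assms(2)])
qed

lemma graph_laplacian_carrier: "graph_laplacian n a \<in> carrier_mat n n"
  by (simp add: graph_laplacian_def)

lemma graph_laplacian_mult_vec:
  assumes "w \<in> carrier_vec n" "r < n"
  shows "(graph_laplacian n a *\<^sub>v w) $ r =
    (\<Sum>j\<in>{1..n} - {Suc r}. a (Suc r) j * (w $ r - w $ (j - 1)))"
proof -
  have "(graph_laplacian n a *\<^sub>v w) $ r = (\<Sum>k<n. graph_laplacian n a $$ (r, k) * w $ k)"
    using assms graph_laplacian_carrier[of n a] by (simp add: scalar_prod_def atLeast0LessThan)
  then show ?thesis by (simp add: graph_laplacian_row[OF assms(2)])
qed

text \<open>Constant vectors are annihilated, since each row of the product is a sum of weighted
  differences.\<close>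

lemma graph_laplacian_eigenvalue_0:
  assumes "n > 0"
  shows "eigenvalue (graph_laplacian n a) 0"
proof -
  let ?w = "vec n (\<lambda>_. 1 :: real)"
  have "?w \<noteq> 0\<^sub>v n" using assms by (auto simp: vec_eq_iff)
  moreover have "graph_laplacian n a *\<^sub>v ?w = 0 \<cdot>\<^sub>v ?w"
    by (rule eq_vecI)
       (use graph_laplacian_carrier[of n a] in \<open>auto simp: graph_laplacian_mult_vec simp del: index_mult_mat_vec intro!: sum.neutral\<close>)
  ultimately show ?thesis
    using graph_laplacian_carrier[of n a] by (auto simp: eigenvalue_def eigenvector_def intro!: exI[of _ ?w])
qed

text \<open>The eigenvalue equation is read off at a vertex where the eigenvector is largest in
  absolute value.\<close>

lemma graph_laplacian_eigenvalue_nonneg: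
  assumes wg: "weighted_graph n a" and ev: "eigenvalue (graph_laplacian n a) l"
  shows "0 \<le> l"
proof -
  obtain w where w: "w \<in> carrier_vec n" "w \<noteq> 0\<^sub>v n" "graph_laplacian n a *\<^sub>v w = l \<cdot>\<^sub>v w"
    using ev graph_laplacian_carrier[of n a] by (auto simp: eigenvalue_def eigenvector_def)
  obtain k where k: "k < n" "w $ k \<noteq> 0"
    using w(1,2) by (auto simp: vec_eq_iff)
  define m where "m = Max ((\<lambda>r. \<bar>w $ r\<bar>) ` {..<n})"
  have "m \<in> (\<lambda>r. \<bar>w $ r\<bar>) ` {..<n}" unfolding m_def using k by (intro Max_in) auto
  then obtain r where r: "r < n" "\<bar>w $ r\<bar> = m" by auto
  have max: "\<bar>w $ s\<bar> \<le> \<bar>w $ r\<bar>" if "s < n" for s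
    unfolding r m_def using that by (intro Max_ge) auto
  have pos: "w $ r \<noteq> 0" using max[OF k(1)] k(2) by auto
  \<comment> \<open>Multiplying the equation at \<open>r\<close> by \<open>w $ r\<close> covers both
    signs of that entry at once.\<close>
  have "0 \<le> (\<Sum>j\<in>{1..n} - {Suc r}. a (Suc r) j * (w $ r * w $ r - w $ (j - 1) * w $ r))"
  proof (rule sum_nonneg)
    fix j assume j: "j \<in> {1..n} - {Suc r}"
    have "w $ (j - 1) * w $ r \<le> \<bar>w $ (j - 1)\<bar> * \<bar>w $ r\<bar>"
      by (metis abs_ge_self abs_mult)
    also have "\<dots> \<le> \<bar>w $ r\<bar> * \<bar>w $ r\<bar>"
      using j by (intro mult_right_mono max) auto
    also have "\<dots> = w $ r * w $ r" by simp
    finally show "0 \<le> a (Suc r) j * (w $ r * w $ r - w $ (j - 1) * w $ r)"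
      using wg r j by (intro mult_nonneg_nonneg) (auto simp: weighted_graph_def)
  qed
  also have "\<dots> = (graph_laplacian n a *\<^sub>v w) $ r * w $ r"
    unfolding graph_laplacian_mult_vec[OF w(1) r(1)] sum_distrib_right
    by (rule sum.cong) (simp_all add: algebra_simps)
  also have "\<dots> = l * (w $ r * w $ r)" using w r by simp
  finally have "0 \<le> l * (w $ r * w $ r)" .
  moreover have "0 < w $ r * w $ r" using pos not_real_square_gt_zero by blast
  ultimately show ?thesis by (meson mult_neg_pos not_le)
qed

subsection \<open>Long cycles\<close>

text \<open>The conjugate of \<open>g\<close> under the renumbering of vertices as matrix rows,
  extended by the identity.\<close>

definition shift_perm :: "nat \<Rightarrow> (nat \<Rightarrow> nat) \<Rightarrow> nat \<Rightarrow> nat" where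
  "shift_perm n g r = (if r < n then g (Suc r) - 1 else r)"

lemma Suc_shift_perm:
  assumes "g \<in> Sym n" "r < n"
  shows "Suc (shift_perm n g r) = g (Suc r)" "shift_perm n g r < n"
proof -
  have "g (Suc r) \<in> {1..n}"
    using assms permutes_in_image[of g "{1..n}" "Suc r"] by (simp add: Sym_def)
  then show "Suc (shift_perm n g r) = g (Suc r)" "shift_perm n g r < n"
    using assms(2) by (auto simp: shift_perm_def)
qed

lemma shift_perm_permutes:
  assumes g: "g \<in> Sym n"
  shows "shift_perm n g permutes {..<n}"
proof (rule bij_imp_permutes)
  have "inj_on (shift_perm n g) {..<n}"
  proof (rule inj_onI)
    fix r s assume rs: "r \<in> {..<n}" "s \<in> {..<n}" "shift_perm n g r = shift_perm n g s"
    then have "g (Suc r) = g (Suc s)" using Suc_shift_perm(1)[OF g] by (metis lessThan_iff)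
    with g show "r = s" by (auto simp: Sym_def dest: permutes_inj injD)
  qed
  then show "bij_betw (shift_perm n g) {..<n} {..<n}"
    using Suc_shift_perm(2)[OF g] by (intro bij_betw_imageI endo_inj_surj) auto
qed (simp add: shift_perm_def)

text \<open>An orbit with \<open>n\<close> elements is all of \<open>{1..n}\<close>, so having one
  means transitivity, stated through invariant sets as in \<open>perm_det_quotient\<close>.\<close>

lemma cycle_count_full_iff:
  assumes g: "g \<in> Sym n" and n: "n > 0"
  shows "cycle_count n n g = 1 \<longleftrightarrow>
    (\<forall>S. S \<subseteq> {..<n} \<and> S \<noteq> {} \<and> shift_perm n g ` S \<subseteq> S \<longrightarrow> S = {..<n})"
    (is "_ \<longleftrightarrow> ?trans")
proof -
  have perm: "g permutes {1..n}" using g by (simp add: Sym_def)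
  have sub: "orbit g i \<subseteq> {1..n}" if "i \<in> {1..n}" for i
    using permutes_orbit_subset[OF perm that] .
  have "{C \<in> orbit g ` {1..n}. card C = n} = {C \<in> orbit g ` {1..n}. C = {1..n}}"
  proof (rule Collect_cong, rule conj_cong[OF refl])
    fix C assume "C \<in> orbit g ` {1..n}"
    then have "C \<subseteq> {1..n}" using sub by blast
    then show "card C = n \<longleftrightarrow> C = {1..n}" using card_subset_eq[of "{1..n}" C] by auto
  qed
  also have "\<dots> = (if {1..n} \<in> orbit g ` {1..n} then {{1..n}} else {})" by auto
  finally have "cycle_count n n g = 1 \<longleftrightarrow> {1..n} \<in> orbit g ` {1..n}"
    unfolding cycle_count_def by simp
  also have "\<dots> \<longleftrightarrow> ?trans"
  proof
    assume "{1..n} \<in> orbit g ` {1..n}"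
    then have cyc: "cyclic_on g {1..n}" unfolding cyclic_on_def by auto
    show ?trans
    proof (intro allI impI, elim conjE)
      fix S assume S: "S \<subseteq> {..<n}" "S \<noteq> {}" "shift_perm n g ` S \<subseteq> S"
      then obtain s where s: "s \<in> S" by blast
      have step: "g (Suc r) \<in> Suc ` S" if "r \<in> S" for r
        using that S Suc_shift_perm(1)[OF g, of r] by (metis imageI image_subset_iff lessThan_iff subsetD)
      have "y \<in> Suc ` S" if "y \<in> orbit g (Suc s)" for y
        using that by induction (use s step in auto)
      moreover have "orbit g (Suc s) = {1..n}"
      proof -
        have "Suc s \<in> {1..n}" using s S(1) by auto
        then show ?thesis using cyc unfolding cyclic_on_alldef by metis
      qed
      ultimately have "{1..n} \<subseteq> Suc ` S" by auto
      then have "r \<in> S" if "r < n" for r using that by (auto dest: subsetD[where c = "Suc r"])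
      then show "S = {..<n}" using S by auto
    qed
  next
    assume tr: ?trans
    \<comment> \<open>The orbit of vertex 1, in row numbering, is the invariant set to test.\<close>
    define S where "S = {r. r < n \<and> Suc r \<in> orbit g 1}"
    \<comment> \<open>\<open>orbit g 1\<close> is generated from \<open>g 1\<close>; it returns to 1
      because \<open>g\<close> is a permutation of a finite set.\<close>
    have "1 \<in> orbit g 1"
      using perm by (intro permutation_self_in_orbit) (auto simp: permutation_permutes)
    then have "0 \<in> S" using n by (simp add: S_def)
    moreover have "shift_perm n g ` S \<subseteq> S"
    proof
      fix v assume "v \<in> shift_perm n g ` S"
      then obtain r where r: "v = shift_perm n g r" "r < n" "Suc r \<in> orbit g 1"
        unfolding S_def by blast
      have "Suc v \<in> orbit g 1"
        unfolding r(1) Suc_shift_perm(1)[OF g r(2)] by (rule orbit.step[OF r(3)])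
      then show "v \<in> S" unfolding S_def using r Suc_shift_perm(2)[OF g r(2)] by simp
    qed
    moreover have "S \<subseteq> {..<n}" unfolding S_def by blast
    ultimately have "S = {..<n}" using tr by blast
    have "{1..n} \<subseteq> orbit g 1"
    proof
      fix v assume "v \<in> {1..n}"
      then obtain r where "v = Suc r" "r < n" by (cases v) auto
      then show "v \<in> orbit g 1" using \<open>S = {..<n}\<close> unfolding S_def by blast
    qed
    then show "{1..n} \<in> orbit g ` {1..n}" using sub[of 1] n by auto
  qed
  finally show ?thesis .
qed

subsection \<open>The interchange process\<close>

text \<open>The finite-dimensional distributions always include time 0, so the law at time
  \<open>t\<close> is obtained from the times 0 and \<open>t\<close> after discarding the almost
  sure event of starting at the identity.\<close>

lemma interchange_process_distribution:
  assumes X: "interchange_process n a M X" and t: "0 \<le> t" and g: "g \<in> Sym n"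
  shows "measure M {w \<in> space M. X t w = g} = heat_kernel n a t g"
proof -
  interpret prob_space M using X by (simp add: interchange_process_def)
  have meas: "X s \<in> measurable M (count_space (Sym n))" if "0 \<le> s" for s
    using X that by (simp add: interchange_process_def)
  have ev: "{w \<in> space M. X s w = h} \<in> events" if "0 \<le> s" "h \<in> Sym n" for s h
    using measurable_sets[OF meas[OF that(1)], of "{h}"] that(2)
    by (simp add: vimage_def Int_def conj_commute)
  have fdd: "prob {w \<in> space M. \<forall>k\<le>m. X (\<tau> k) w = h k} =
      (\<Prod>k<m. heat_kernel n a (\<tau> (Suc k) - \<tau> k) (h (Suc k) \<circ> inv_into UNIV (h k)))"
    if "\<tau> 0 = 0" "\<forall>k<m. \<tau> k \<le> \<tau> (Suc k)" "h 0 = id" "\<forall>k\<le>m. h k \<in> Sym n" for m \<tau> h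
    using X that by (simp add: interchange_process_def)
  \<comment> \<open>With \<open>m = 0\<close> the product of transition probabilities is
    empty.\<close>
  have "prob {w \<in> space M. X 0 w = id} = 1"
    using fdd[of "\<lambda>_. 0" 0 "\<lambda>_. id"] id_in_Sym by simp
  then have AE0: "AE w in M. X 0 w = id"
    using prob_Collect_eq_1[OF ev[OF order_refl id_in_Sym]] by simp
  define \<tau> where "\<tau> k = (if k = 0 then 0 else t)" for k :: nat
  define h where "h k = (if k = 0 then id else g)" for k :: nat
  have "{w \<in> space M. \<forall>k\<le>Suc 0. X (\<tau> k) w = h k} =
      {w \<in> space M. X 0 w = id} \<inter> {w \<in> space M. X t w = g}"
    by (auto simp: le_Suc_eq \<tau>_def h_def)
  moreover have "prob ({w \<in> space M. X 0 w = id} \<inter> {w \<in> space M. X t w = g}) =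
      prob {w \<in> space M. X t w = g}"
  proof (rule finite_measure_eq_AE)
    show "AE w in M. w \<in> {w \<in> space M. X 0 w = id} \<inter> {w \<in> space M. X t w = g} \<longleftrightarrow>
        w \<in> {w \<in> space M. X t w = g}"
      using AE0 by eventually_elim auto
    show "{w \<in> space M. X 0 w = id} \<inter> {w \<in> space M. X t w = g} \<in> events"
      by (intro sets.Int ev t g id_in_Sym order_refl)
    show "{w \<in> space M. X t w = g} \<in> events" by (rule ev[OF t g])
  qed
  moreover have "prob {w \<in> space M. \<forall>k\<le>Suc 0. X (\<tau> k) w = h k} = heat_kernel n a t g"
    by (subst fdd) (use t g id_in_Sym in \<open>auto simp: \<tau>_def h_def\<close>)
  ultimately show ?thesis by simp
qed

lemma interchange_process_event:
  assumes X: "interchange_process n a M X" and t: "0 \<le> t"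
  shows "measure M {w \<in> space M. R (X t w)} = (\<Sum>g | g \<in> Sym n \<and> R g. heat_kernel n a t g)"
proof -
  interpret prob_space M using X by (simp add: interchange_process_def)
  have meas: "X t \<in> measurable M (count_space (Sym n))"
    using X t by (simp add: interchange_process_def)
  have ev: "{w \<in> space M. X t w = h} \<in> events" if "h \<in> Sym n" for h
    using measurable_sets[OF meas, of "{h}"] that by (simp add: vimage_def Int_def conj_commute)
  have "{w \<in> space M. R (X t w)} = (\<Union>g\<in>{g. g \<in> Sym n \<and> R g}. {w \<in> space M. X t w = g})"
    using measurable_space[OF meas] by auto
  also have "prob \<dots> = (\<Sum>g | g \<in> Sym n \<and> R g. prob {w \<in> space M. X t w = g})"
    using finite_Sym by (intro finite_measure_finite_Union) (auto simp: disjoint_family_on_def ev)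
  also have "\<dots> = (\<Sum>g | g \<in> Sym n \<and> R g. heat_kernel n a t g)"
    by (rule sum.cong) (auto simp: interchange_process_distribution[OF X t])
  finally show ?thesis .
qed

text \<open>Apply \<open>heat_kernel_pairing\<close> to \<open>moved_det\<close> with the heat
  semigroup \<open>E t\<close>: at time 0 it is \<open>perm_det\<close>, and at the identity it is
  the determinant of \<open>1 - x * E t\<close>.\<close>

lemma heat_kernel_perm_det:
  assumes wg: "weighted_graph n a"
    and cp: "char_poly (graph_laplacian n a) = (\<Prod>i<n. [:- ev i, 1:])"
  shows "(\<Sum>g\<in>Sym n. heat_kernel n a t g * perm_det n (shift_perm n g) x) =
    (\<Prod>i<n. 1 - x * exp (- ev i * t))"
proof -
  obtain E where E:
    "\<And>t i j. i < n \<Longrightarrow> j < n \<Longrightarrow> ((\<lambda>t. E t i j) has_field_derivative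
      - (\<Sum>k<n. graph_laplacian n a $$ (i, k) * E t k j)) (at t)"
    "\<And>i j. i < n \<Longrightarrow> j < n \<Longrightarrow> E 0 i j = of_bool (i = j)"
    "\<And>t x. rdet n (\<lambda>i j. of_bool (i = j) - x * E t i j) = (\<Prod>i<n. 1 - x * exp (- ev i * t))"
    using semigroup_exists[OF graph_laplacian_carrier cp] by blast
  define e where "e t v s = E t (v - 1) s" for t v s
  have "((\<lambda>t. moved_det n (e t) x g) has_field_derivative
      interchange_gen n a (moved_det n (e t) x) g) (at t)" if "g \<in> Sym n" for g t
  proof (rule moved_det_deriv[OF _ that])
    fix v s assume v: "v \<in> {1..n}" and s: "s < n"
    then obtain r where r: "v = Suc r" "r < n" by (cases v) auto
    show "((\<lambda>t. e t v s) has_field_derivative (\<Sum>(j, i)\<in>edges n.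
        a i j * ((of_bool (v = j) - of_bool (v = i)) * (e t i s - e t j s)))) (at t)"
      using E(1)[OF r(2) s, of t] graph_laplacian_row_edges[OF wg r(2), of "\<lambda>k. E t k s"]
      by (simp add: e_def r)
  qed
  note heat_kernel_pairing[of n "\<lambda>t. moved_det n (e t) x" a t, OF this]
  moreover have "moved_det n (e 0) x g = perm_det n (shift_perm n g) x" if "g \<in> Sym n" for g
    unfolding moved_det_def perm_det_def
  proof (rule rdet_cong)
    fix i j assume ij: "i < n" "j < n"
    show "of_bool (i = j) - x * e 0 (g (Suc i)) j = of_bool (i = j) - x * of_bool (shift_perm n g i = j)"
      unfolding e_def Suc_shift_perm(1)[OF that ij(1), symmetric]
      using E(2)[OF Suc_shift_perm(2)[OF that ij(1)] ij(2)] by simp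
  qed
  moreover have "moved_det n (e t) x id = (\<Prod>i<n. 1 - x * exp (- ev i * t))"
    using E(3)[of x t] by (simp add: moved_det_def e_def)
  ultimately show ?thesis by simp
qed

lemma graph_laplacian_min_eigenvalue:
  assumes n: "n > 0" and wg: "weighted_graph n a"
    and mono: "\<And>i j. i \<le> j \<Longrightarrow> j < n \<Longrightarrow> ev i \<le> ev j"
    and cp: "char_poly (graph_laplacian n a) = (\<Prod>i<n. [:- ev i, 1:])"
  shows "ev 0 = 0"
proof -
  have root: "eigenvalue (graph_laplacian n a) l \<longleftrightarrow> (\<exists>i<n. l = ev i)" for l
    unfolding eigenvalue_root_char_poly[OF graph_laplacian_carrier] cp
    by (auto simp: poly_prod)
  obtain i where i: "i < n" "ev i = 0"
    using graph_laplacian_eigenvalue_0[OF n, of a] root by metis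
  moreover have "0 \<le> ev 0"
    using graph_laplacian_eigenvalue_nonneg[OF wg] root n by blast
  ultimately show ?thesis using mono[of 0 i] by simp
qed

theorem theorem1:
  fixes n :: nat and a :: "nat \<Rightarrow> nat \<Rightarrow> real" and ev :: "nat \<Rightarrow> real"
    and M :: "'w measure" and X :: "real \<Rightarrow> 'w \<Rightarrow> nat \<Rightarrow> nat"
  assumes "1 \<le> n"
    and "weighted_graph n a"
    and "\<forall>i j. i \<le> j \<and> j < n \<longrightarrow> ev i \<le> ev j"
    and "char_poly (graph_laplacian n a) = (\<Prod>i<n. [:- ev i, 1:])"
    and "interchange_process n a M X"
  shows "ev 0 = 0 \<and>
    (\<forall>t\<ge>0. measure M {w \<in> space M. cycle_count n n (X t w) = 1} =
      1 / real n * (\<Prod>i = 1..n - 1. 1 - exp (- ev i * t)))"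
proof (intro conjI allI impI)
  have n: "n > 0" using assms(1) by simp
  show ev0: "ev 0 = 0"
    by (rule graph_laplacian_min_eigenvalue[OF n assms(2) _ assms(4)]) (simp add: assms(3))
  fix t :: real assume t: "0 \<le> t"
  \<comment> \<open>The quotients by \<open>1 - x\<close>, one for each permutation, encode the
    event of a long cycle in their values at 1.\<close>
  have "\<forall>g\<in>Sym n. \<exists>H. isCont H 1 \<and> (\<forall>x. perm_det n (shift_perm n g) x = (1 - x) * H x) \<and>
      H 1 = (if cycle_count n n g = 1 then real n else 0)"
  proof
    fix g assume g: "g \<in> Sym n"
    show "\<exists>H. isCont H 1 \<and> (\<forall>x. perm_det n (shift_perm n g) x = (1 - x) * H x) \<and>
        H 1 = (if cycle_count n n g = 1 then real n else 0)"
      unfolding cycle_count_full_iff[OF g n] by (rule perm_det_quotient[OF shift_perm_permutes[OF g] n])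
  qed
  from bchoice[OF this] obtain H where H: "\<And>g. g \<in> Sym n \<Longrightarrow> isCont (H g) 1"
    "\<And>g x. g \<in> Sym n \<Longrightarrow> perm_det n (shift_perm n g) x = (1 - x) * H g x"
    "\<And>g. g \<in> Sym n \<Longrightarrow> H g 1 = (if cycle_count n n g = 1 then real n else 0)"
    by blast
  let ?S = "\<lambda>x. \<Sum>g\<in>Sym n. heat_kernel n a t g * H g x"
  let ?K = "\<lambda>x. \<Prod>i = 1..n - 1. 1 - x * exp (- ev i * t)"
  \<comment> \<open>Since \<open>ev 0 = 0\<close>, the factor for index 0 is \<open>1 - x\<close>;
    cancelling it requires \<open>x\<close> to differ from 1.\<close>
  have eq: "?S x = ?K x" if "x \<noteq> 1" for x
  proof -
    have "(1 - x) * ?S x = (\<Prod>i<n. 1 - x * exp (- ev i * t))"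
      unfolding heat_kernel_perm_det[OF assms(2,4), symmetric] sum_distrib_left
      by (rule sum.cong) (simp_all add: H(2))
    also have "{..<n} = insert 0 {1..n - 1}" using n by auto
    also have "(\<Prod>i\<in>insert 0 {1..n - 1}. 1 - x * exp (- ev i * t)) = (1 - x) * ?K x"
      by (subst prod.insert) (auto simp: ev0)
    finally show ?thesis using that by simp
  qed
  \<comment> \<open>Both sides are continuous at 1, so the identity extends there, where
    \<open>?S 1\<close> is \<open>n\<close> times the probability sought.\<close>
  have "isCont ?S 1" by (intro continuous_intros H(1))
  moreover have "(?S \<longlongrightarrow> ?K 1) (at 1)"
  proof (rule Lim_transform_eventually)
    have "isCont ?K 1" by (intro continuous_intros)
    then show "(?K \<longlongrightarrow> ?K 1) (at 1)" by (simp add: isCont_def)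
    show "\<forall>\<^sub>F x in at 1. ?K x = ?S x" using eq by (auto simp: eventually_at_filter)
  qed
  ultimately have "?S 1 = ?K 1" unfolding isCont_def by (rule LIM_unique)
  moreover have "?S 1 = (\<Sum>g\<in>Sym n. if cycle_count n n g = 1 then real n * heat_kernel n a t g else 0)"
    by (rule sum.cong) (simp_all add: H(3))
  moreover have "\<dots> = real n * measure M {w \<in> space M. cycle_count n n (X t w) = 1}"
    unfolding interchange_process_event[OF assms(5) t, of "\<lambda>g. cycle_count n n g = 1"] sum_distrib_left
    by (rule sum.inter_filter[OF finite_Sym, symmetric])
  ultimately show "measure M {w \<in> space M. cycle_count n n (X t w) = 1} =
      1 / real n * (\<Prod>i = 1..n - 1. 1 - exp (- ev i * t))"
    using n by (simp add: field_simps)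
qed

end
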